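(* Let $p \geqslant 3$ be a prime and let $G$ be a finite abelian $p$-group such that $\mathsf{D}(G)=2\exp(G)-c$ for some integer $1\leqslant c\leqslant \exp(G)$. Then $$\mathsf{s}(G)\leqslant\mathsf{D}(G)+2\exp(G)-\frac{c-1}{2}-2.$$
   Context: A sequence over a finite abelian group $G$ is a finite unordered list $S=g_1\cdots g_\ell$ of elements of $G$ with repetition allowed; $|S|=\ell$ is its length and $\sigma(S)=\sum_i g_i$ its sum; a subsequence is a sub-multiset. $\mathsf{D}(G)$ (Davenport constant) is the smallest positive integer $N$ such that every sequence over $G$ of length at least $N$ has a nonempty subsequence with sum $0$. $\mathsf{s}(G)$ (Erdős–Ginzburg–Ziv constant) is the smallest positive integer $N$ such that every sequence over $G$ of length at least $N$ has a subsequence $T$ with $\sigma(T)=0$ and $|T|=\exp(G)$. *)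

theory Defs
  imports Complex_Main "HOL-Library.Multiset" "HOL-Computational_Algebra.Primes"
    "HOL-Algebra.FiniteProduct" "HOL-Algebra.Coset"
begin

text \<open>
  Finite abelian groups are commutative groups of HOL-Algebra, hence written multiplicatively:
  the group operation is the addition of the source and the unit is its zero element.
  A sequence over \<open>G\<close> is a finite multiset of elements of the carrier, its length is \<^const>\<open>size\<close>
  and subsequences are ordered by \<^const>\<open>subseteq_mset\<close>.
\<close>

definition sequence_over :: "('a, 'b) monoid_scheme \<Rightarrow> 'a multiset \<Rightarrow> bool" where
  "sequence_over G S \<longleftrightarrow> set_mset S \<subseteq> carrier G"

text \<open>The sum \<open>\<sigma>(S)\<close>: each group element is taken as often as it occurs in \<open>S\<close>.\<close>

definition seq_sum :: "('a, 'b) monoid_scheme \<Rightarrow> 'a multiset \<Rightarrow> 'a" where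
  "seq_sum G S = (\<Otimes>\<^bsub>G\<^esub>g\<in>set_mset S. g [^]\<^bsub>G\<^esub> count S g)"

definition group_exponent :: "('a, 'b) monoid_scheme \<Rightarrow> nat" where
  "group_exponent G =
     (LEAST n::nat. 0 < n \<and> (\<forall>g\<in>carrier G. g [^]\<^bsub>G\<^esub> n = \<one>\<^bsub>G\<^esub>))"

text \<open>
  For a finite abelian group the sets of numbers minimised in the three least-number definitions
  here are nonempty: they contain \<open>order G\<close>, \<open>order G\<close> and
  \<open>order G * (group_exponent G - 1) + 1\<close> respectively.
\<close>

definition davenport_constant :: "('a, 'b) monoid_scheme \<Rightarrow> nat" where
  "davenport_constant G =
     (LEAST N. 0 < N \<and>
        (\<forall>S. sequence_over G S \<and> N \<le> size S \<longrightarrow>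
           (\<exists>T. T \<subseteq># S \<and> T \<noteq> {#} \<and> seq_sum G T = \<one>\<^bsub>G\<^esub>)))"

definition egz_constant :: "('a, 'b) monoid_scheme \<Rightarrow> nat" where
  "egz_constant G =
     (LEAST N. 0 < N \<and>
        (\<forall>S. sequence_over G S \<and> N \<le> size S \<longrightarrow>
           (\<exists>T. T \<subseteq># S \<and> seq_sum G T = \<one>\<^bsub>G\<^esub> \<and> size T = group_exponent G)))"

text \<open>
  A finite \<open>p\<close>-group is a group of order a power of \<open>p\<close>; the trivial group is included.
  For a prime \<open>p\<close> finiteness is already implied, because \<^const>\<open>order\<close> is 0 for an infinite carrier;
  it is stated for explicitness.
\<close>

definition finite_p_group :: "nat \<Rightarrow> ('a, 'b) monoid_scheme \<Rightarrow> bool" where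
  "finite_p_group p G \<longleftrightarrow> group G \<and> finite (carrier G) \<and> (\<exists>k. order G = p ^ k)"

end

theory Submission
  imports Defs "HOL-Algebra.Multiplicative_Group"
begin

text \<open>
  Write \<open>q\<close> for the exponent, \<open>D = 2q - c\<close> for the Davenport constant and \<open>h = \<lfloor>c/2\<rfloor>\<close>.
  By Olson's theorem a product of \<open>D\<close> factors \<open>1 - g\<close> vanishes in the group ring of \<open>G\<close> over the
  field of \<open>p\<close> elements. Expanding \<open>1 - g z = (1 - g) z + (1 - z)\<close> shows that the polynomial
  \<open>\<Sum>\<^sub>i (-1)\<^sup>i N\<^sub>i z\<^sup>i\<close>, where \<open>N\<^sub>i\<close> counts the zero-sum subsequences of length \<open>i\<close> of a sequence
  of length \<open>m\<close>, is divisible by \<open>(1 - z)\<close> to the power \<open>m - D + 1\<close> modulo \<open>p\<close>.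

  Suppose that a sequence of length \<open>m = 4q - 2 - c - h\<close> has no zero-sum subsequence of length \<open>q\<close>.
  Then it has none of length \<open>3q\<close> either, and each subsequence of length at least \<open>3q - c - 1\<close> has
  \<open>N\<^bsub>2q\<^esub> \<equiv> -1\<close>. As in Reiher's proof of the Kemnitz conjecture, counting disjoint pairs of zero-sum
  subsequences of lengths \<open>r\<close> and \<open>2q\<close> in two ways gives \<open>N\<^sub>r \<equiv> N\<^bsub>2q+r\<^esub>\<close> whenever
  \<open>q - c - 1 \<le> r \<le> q - 1 - h\<close>. Divisibility by \<open>(1 - z)\<close> to the power \<open>2q - 1 - h\<close> says that
  \<open>r \<mapsto> (-1)\<^sup>r (-N\<^bsub>q+r\<^esub> + 2 N\<^bsub>2q+r\<^esub> - 3 N\<^bsub>3q+r\<^esub>)\<close> has vanishing differences of order \<open>h + 1\<close> on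
  \<open>0 \<le> r < q\<close>. It vanishes on that window of at least \<open>h + 1\<close> places, hence also at \<open>0\<close>, where its
  value is \<open>2 N\<^bsub>2q\<^esub> \<equiv> -2\<close>; this contradicts \<open>p \<noteq> 2\<close>.
\<close>

section \<open>Iterated differences modulo a prime\<close>

text \<open>This is \<open>1 - E\<close> for the shift \<open>E\<close>; the sign matches the
  factors \<open>1 - g\<close> of the group ring.\<close>

definition fdiff :: "(nat \<Rightarrow> int) \<Rightarrow> nat \<Rightarrow> int" where
  "fdiff w = (\<lambda>t. w t - w (Suc t))"

lemma funpow_fdiff: "(fdiff ^^ n) w t = (\<Sum>i\<le>n. (-1) ^ i * int (n choose i) * w (t + i))"
proof (induction n arbitrary: t)
  case (Suc n)
  have "(\<Sum>i\<le>n. (-1) ^ i * int (n choose i) * w (t + i))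
      = (\<Sum>i\<le>Suc n. (-1) ^ i * int (n choose i) * w (t + i))"
    by simp
  also have "\<dots> = w t + (\<Sum>i\<le>n. (-1) ^ Suc i * int (n choose Suc i) * w (t + Suc i))"
    by (subst sum.atMost_Suc_shift) simp
  finally have *: "(\<Sum>i\<le>n. (-1) ^ i * int (n choose i) * w (t + i)) = \<dots>" .
  have "(fdiff ^^ Suc n) w t = (fdiff ^^ n) w t - (fdiff ^^ n) w (Suc t)"
    by (simp add: fdiff_def)
  also have "\<dots> = w t + (\<Sum>i\<le>n. (-1) ^ Suc i * int (n choose Suc i) * w (t + Suc i))
      - (\<Sum>i\<le>n. (-1) ^ i * int (n choose i) * w (Suc t + i))"
    unfolding Suc.IH * ..
  also have "\<dots> = w t + (\<Sum>i\<le>n. (-1) ^ Suc i * int (Suc n choose Suc i) * w (t + Suc i))"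
    by (simp add: sum_subtractf [symmetric] sum_negf [symmetric] sum.distrib [symmetric] algebra_simps
        cong: sum.cong)
  also have "\<dots> = (\<Sum>i\<le>Suc n. (-1) ^ i * int (Suc n choose i) * w (t + i))"
    by (subst sum.atMost_Suc_shift) simp
  finally show ?case .
qed simp

text \<open>Absorption: \<open>i\<close> times the coefficient is a multiple of
  \<open>p ^ k\<close>. If \<open>p\<close> did not divide the coefficient, \<open>p ^ k\<close>
  would divide the smaller number \<open>i\<close>.\<close>

lemma prime_dvd_prime_power_choose:
  assumes "Factorial_Ring.prime (p::nat)" "0 < i" "i < p ^ k"
  shows "p dvd (p ^ k choose i)"
proof (rule ccontr)
  assume "\<not> p dvd (p ^ k choose i)"
  then have "coprime (p ^ k) (p ^ k choose i)"
    using assms(1) by (simp add: prime_imp_coprime)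
  moreover have "p ^ k dvd i * (p ^ k choose i)"
    using assms(2) by (simp add: times_binomial_minus1_eq)
  ultimately have "p ^ k dvd i"
    by (simp add: coprime_dvd_mult_left_iff)
  then show False
    using assms by (auto dest: dvd_imp_le)
qed

text \<open>Frobenius for the shift \<open>E\<close>: modulo \<open>p\<close> only the outer terms
  of \<open>(1 - E)^q\<close> with \<open>q = p ^ k\<close> survive, and oddness of \<open>q\<close>
  makes the last one \<open>- E^q\<close>.\<close>

lemma funpow_fdiff_prime_power:
  assumes "Factorial_Ring.prime p" "odd p"
  shows "int p dvd (fdiff ^^ (p ^ k)) w t - (w t - w (t + p ^ k))"
proof -
  define q where "q = p ^ k"
  have q: "0 < q" "odd q"
    using assms by (auto simp: q_def prime_gt_0_nat)
  let ?f = "\<lambda>i. (-1) ^ i * int (q choose i) * w (t + i)"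
  have "{..q} = insert 0 (insert q {0<..<q})"
    using q by auto
  then have "sum ?f {..q} = w t - w (t + q) + sum ?f {0<..<q}"
    using q by simp
  moreover have "int p dvd sum ?f {0<..<q}"
  proof (rule dvd_sum)
    fix i assume "i \<in> {0<..<q}"
    then have "p dvd (q choose i)"
      using prime_dvd_prime_power_choose [OF assms(1)] by (simp add: q_def)
    then show "int p dvd ?f i"
      by simp
  qed
  ultimately show ?thesis
    unfolding funpow_fdiff q_def by simp
qed

lemma funpow_fdiff_cong:
  "(\<And>t. int p dvd u t - w t) \<Longrightarrow> int p dvd (fdiff ^^ n) u t - (fdiff ^^ n) w t"
  unfolding funpow_fdiff sum_subtractf [symmetric] right_diff_distrib [symmetric]
  by (intro dvd_sum dvd_mult)

text \<open>The group ring modulo \<open>p\<close> is represented by its action on integer functions: the condition says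
  that \<open>f\<close> modulo \<open>p\<close> is annihilated by all products of \<open>d\<close> factors \<open>1 - h\<close> with \<open>h \<in> X\<close>.\<close>

primrec diff_vanish ::
  "('a, 'b) monoid_scheme \<Rightarrow> nat \<Rightarrow> 'a set \<Rightarrow> nat \<Rightarrow> ('a \<Rightarrow> int) \<Rightarrow> bool" where
  "diff_vanish G p X 0 f \<longleftrightarrow> (\<forall>x\<in>carrier G. int p dvd f x)"
| "diff_vanish G p X (Suc d) f \<longleftrightarrow> (\<forall>h\<in>X. diff_vanish G p X d (\<lambda>x. f x - f (x \<otimes>\<^bsub>G\<^esub> h)))"

section \<open>Annihilators of powers of the augmentation ideal\<close>

context comm_group
begin

lemma diff_vanish_cong:
  assumes "X \<subseteq> carrier G" "\<And>x. x \<in> carrier G \<Longrightarrow> f x = g x" "diff_vanish G p X d f"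
  shows "diff_vanish G p X d g"
  using assms(2,3)
proof (induction d arbitrary: f g)
  case (Suc d)
  show ?case
    unfolding diff_vanish.simps
  proof
    fix h assume h: "h \<in> X"
    then have "h \<in> carrier G"
      using assms(1) by auto
    then show "diff_vanish G p X d (\<lambda>x. g x - g (x \<otimes> h))"
      using Suc.prems h by (rule_tac Suc.IH [of "\<lambda>x. f x - f (x \<otimes> h)"]) auto
  qed
qed simp

lemma diff_vanish_add:
  "diff_vanish G p X d f \<Longrightarrow> diff_vanish G p X d g \<Longrightarrow> diff_vanish G p X d (\<lambda>x. f x + g x)"
proof (induction d arbitrary: f g)
  case (Suc d)
  show ?case
    unfolding diff_vanish.simps
  proof
    fix h assume "h \<in> X"
    then have "diff_vanish G p X d (\<lambda>x. (f x - f (x \<otimes> h)) + (g x - g (x \<otimes> h)))"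
      using Suc.prems by (intro Suc.IH) auto
    then show "diff_vanish G p X d (\<lambda>x. f x + g x - (f (x \<otimes> h) + g (x \<otimes> h)))"
      by (simp add: algebra_simps)
  qed
qed simp

lemma diff_vanish_uminus:
  "diff_vanish G p X d f \<Longrightarrow> diff_vanish G p X d (\<lambda>x. - f x)"
proof (induction d arbitrary: f)
  case (Suc d)
  show ?case
    unfolding diff_vanish.simps
  proof
    fix h assume "h \<in> X"
    then have "diff_vanish G p X d (\<lambda>x. - (f x - f (x \<otimes> h)))"
      using Suc.prems by (intro Suc.IH) auto
    then show "diff_vanish G p X d (\<lambda>x. - f x - - f (x \<otimes> h))"
      by (simp add: algebra_simps)
  qed
qed simp

lemma diff_vanish_translate:
  assumes "X \<subseteq> carrier G" "g \<in> carrier G" "diff_vanish G p X d f"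
  shows "diff_vanish G p X d (\<lambda>x. f (x \<otimes> g))"
  using assms(3)
proof (induction d arbitrary: f)
  case (Suc d)
  show ?case
    unfolding diff_vanish.simps
  proof
    fix h assume h: "h \<in> X"
    then have hG: "h \<in> carrier G"
      using assms(1) by auto
    have "diff_vanish G p X d (\<lambda>x. f (x \<otimes> g) - f (x \<otimes> g \<otimes> h))"
      using Suc.prems h by (intro Suc.IH [of "\<lambda>x. f x - f (x \<otimes> h)"]) auto
    then show "diff_vanish G p X d (\<lambda>x. f (x \<otimes> g) - f (x \<otimes> h \<otimes> g))"
      using hG assms(2) by (elim diff_vanish_cong [OF assms(1), rotated]) (simp add: m_ac)
  qed
qed (use assms(2) in simp)

lemma diff_vanish_diff:
  assumes "X \<subseteq> carrier G" "h \<in> carrier G" "diff_vanish G p X d f"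
  shows "diff_vanish G p X d (\<lambda>x. f x - f (x \<otimes> h))"
  using diff_vanish_add [OF assms(3) diff_vanish_uminus [OF diff_vanish_translate [OF assms]]]
  by simp

lemma diff_vanish_mod:
  assumes "X \<subseteq> carrier G" "\<And>x. x \<in> carrier G \<Longrightarrow> int p dvd f x"
  shows "diff_vanish G p X d f"
  using assms(2)
proof (induction d arbitrary: f)
  case (Suc d)
  show ?case
    unfolding diff_vanish.simps
    using assms(1) Suc.prems by (intro ballI Suc.IH dvd_diff) auto
qed simp

text \<open>Pigeonhole: among at least \<open>a + b - 1\<close> factors \<open>1 - h\<close> with
  \<open>h\<close> in \<open>X \<union> Y\<close>, there are \<open>a\<close> from \<open>X\<close>
  or \<open>b\<close> from \<open>Y\<close>.\<close>

lemma diff_vanish_Un: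
  assumes "X \<subseteq> carrier G" "Y \<subseteq> carrier G"
    and "diff_vanish G p X a f" "diff_vanish G p Y b f" "a + b \<le> Suc d"
  shows "diff_vanish G p (X \<union> Y) d f"
  using assms(3-5)
proof (induction d arbitrary: a b f)
  case (0 a b f)
  then have "a = 0 \<or> b = 0"
    by auto
  with 0 show ?case
    by auto
next
  case (Suc d a b f)
  show ?case
  proof (cases "a = 0 \<or> b = 0")
    case True
    with Suc.prems have "\<And>x. x \<in> carrier G \<Longrightarrow> int p dvd f x"
      by auto
    then show ?thesis
      using assms(1,2) by (intro diff_vanish_mod) auto
  next
    case False
    then obtain a' b' where ab: "a = Suc a'" "b = Suc b'"
      by (meson not0_implies_Suc)
    show ?thesis
      unfolding diff_vanish.simps
    proof
      fix h assume "h \<in> X \<union> Y"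
      then show "diff_vanish G p (X \<union> Y) d (\<lambda>x. f x - f (x \<otimes> h))"
      proof
        assume h: "h \<in> X"
        then show ?thesis
          using Suc.prems ab diff_vanish_diff [OF assms(2) subsetD [OF assms(1) h] Suc.prems(2)]
          by (intro Suc.IH [of a' _ b]) auto
      next
        assume h: "h \<in> Y"
        then show ?thesis
          using Suc.prems ab diff_vanish_diff [OF assms(1) subsetD [OF assms(2) h] Suc.prems(1)]
          by (intro Suc.IH [of a _ b']) auto
      qed
    qed
  qed
qed

text \<open>The identities \<open>1 - gh = (1 - g) + g(1 - h)\<close> and
  \<open>1 - h^-1 = - h^-1 (1 - h)\<close> keep the factors of generated elements in the ideal
  spanned by those of \<open>X\<close>.\<close>

lemma diff_vanish_generate:
  assumes "X \<subseteq> carrier G" "diff_vanish G p X d f"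
  shows "diff_vanish G p (generate G X) d f"
  using assms(2)
proof (induction d arbitrary: f)
  case (Suc d)
  have gc: "generate G X \<subseteq> carrier G"
    using assms(1) by (rule generate_incl)
  have "diff_vanish G p X d (\<lambda>x. f x - f (x \<otimes> h))" if "h \<in> generate G X" for h
    using that
  proof (induction rule: generate.induct)
    case one
    then show ?case
      by (rule diff_vanish_mod [OF assms(1)]) simp
  next
    case (incl h)
    then show ?case
      using Suc.prems by simp
  next
    case (inv h)
    then have h: "h \<in> carrier G"
      using assms(1) by auto
    have "diff_vanish G p X d (\<lambda>x. - (f (x \<otimes> inv h) - f (x \<otimes> inv h \<otimes> h)))"
      using Suc.prems inv h
      by (intro diff_vanish_uminus diff_vanish_translate [OF assms(1), of _ _ _ "\<lambda>x. f x - f (x \<otimes> h)"]) auto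
    then show ?case
      by (rule diff_vanish_cong [OF assms(1), rotated]) (use h in \<open>simp add: m_assoc\<close>)
  next
    case (eng g h)
    then have gh: "g \<in> carrier G" "h \<in> carrier G"
      using gc by auto
    have "diff_vanish G p X d (\<lambda>x. (f x - f (x \<otimes> g)) + (f (x \<otimes> g) - f (x \<otimes> g \<otimes> h)))"
      using eng gh
      by (intro diff_vanish_add diff_vanish_translate [OF assms(1), of _ _ _ "\<lambda>x. f x - f (x \<otimes> h)"]) auto
    then show ?case
      by (rule diff_vanish_cong [OF assms(1), rotated]) (use gh in \<open>simp add: m_assoc\<close>)
  qed
  then show ?case
    using Suc.IH by simp
qed simp

text \<open>Along each orbit \<open>x \<otimes> e [^] i\<close> the difference by \<open>e\<close>
  is the difference of an integer sequence, so the results on \<open>fdiff\<close> apply.\<close>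

lemma diff_vanish_singleton_iff:
  assumes "e \<in> carrier G"
  shows "diff_vanish G p {e} n f \<longleftrightarrow>
    (\<forall>x\<in>carrier G. int p dvd (fdiff ^^ n) (\<lambda>i. f (x \<otimes> e [^] i)) 0)"
proof (induction n arbitrary: f)
  case (Suc n)
  have "fdiff (\<lambda>i. f (x \<otimes> e [^] i)) = (\<lambda>i. f (x \<otimes> e [^] i) - f (x \<otimes> e [^] i \<otimes> e))"
    if "x \<in> carrier G" for x
    using that assms by (simp add: fdiff_def m_assoc)
  then show ?case
    by (simp add: Suc.IH funpow_swap1 del: funpow.simps) (simp add: funpow_swap1)
qed simp

lemma diff_vanish_singleton_prime_power:
  assumes "e \<in> carrier G" "Factorial_Ring.prime p" "odd p" "e [^] (p ^ k) = \<one>"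
  shows "diff_vanish G p {e} (p ^ k) f"
  unfolding diff_vanish_singleton_iff [OF assms(1)]
proof
  fix x assume "x \<in> carrier G"
  then show "int p dvd (fdiff ^^ (p ^ k)) (\<lambda>i. f (x \<otimes> e [^] i)) 0"
    using funpow_fdiff_prime_power [OF assms(2,3), of k "\<lambda>i. f (x \<otimes> e [^] i)" 0] assms(4)
    by simp
qed

text \<open>The product rule \<open>\<chi>(x) w(t) - \<chi>(xg) w(t+1) = (\<chi>(x) - \<chi>(xg)) w(t) + \<chi>(xg) (w(t) - w(t+1))\<close>
  spends one difference either on \<open>\<chi>\<close> or on \<open>w\<close> for each element of \<open>J\<close>.\<close>

lemma dvd_weighted_subset_sum:
  assumes "X \<subseteq> carrier G" "finite J" "\<And>j. j \<in> J \<Longrightarrow> s j \<in> X" "a + b \<le> Suc (card J)"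
    and "diff_vanish G p X a f" "\<And>t. int p dvd (fdiff ^^ b) w t" "x \<in> carrier G"
  shows "int p dvd (\<Sum>U\<in>Pow J. (-1) ^ card U * f (x \<otimes> finprod G s U) * w (t + card U))"
  using assms(2-7)
proof (induction J arbitrary: a b f w x t rule: finite_induct)
  case empty
  then have "a = 0 \<or> b = 0"
    by auto
  with empty show ?case
    by auto
next
  case (insert j J a b f w x t)
  have s: "s \<in> insert j J \<rightarrow> carrier G"
    using insert.prems(1) assms(1) by auto
  show ?case
  proof (cases "a = 0 \<or> b = 0")
    case True
    show ?thesis
    proof (rule dvd_sum)
      fix U assume "U \<in> Pow (insert j J)"
      then have "x \<otimes> finprod G s U \<in> carrier G"
        using s insert.prems(5) by (intro m_closed finprod_closed) auto
      then show "int p dvd (-1) ^ card U * f (x \<otimes> finprod G s U) * w (t + card U)"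
        using True insert.prems(3,4) by auto
    qed
  next
    case False
    then obtain a' b' where ab: "a = Suc a'" "b = Suc b'"
      by (meson not0_implies_Suc)
    have sj: "s j \<in> X" "s j \<in> carrier G"
      using insert.prems(1) assms(1) by auto
    define F where "F f w x t = (\<Sum>U\<in>Pow J. (-1) ^ card U * f (x \<otimes> finprod G s U) * w (t + card U))"
      for f :: "'a \<Rightarrow> int" and w :: "nat \<Rightarrow> int" and x t
    \<comment> \<open>Subsets are split by whether they contain \<open>j\<close>; those that do
      carry the opposite sign, an extra factor \<open>s j\<close> and a weight shifted by
      one.\<close>
    have "(\<Sum>U\<in>Pow (insert j J). (-1) ^ card U * f (x \<otimes> finprod G s U) * w (t + card U))
       = F f w x t + (\<Sum>U\<in>insert j ` Pow J. (-1) ^ card U * f (x \<otimes> finprod G s U) * w (t + card U))"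
      unfolding Pow_insert F_def using insert.hyps by (intro sum.union_disjoint) auto
    also have "(\<Sum>U\<in>insert j ` Pow J. (-1) ^ card U * f (x \<otimes> finprod G s U) * w (t + card U))
      = (\<Sum>U\<in>Pow J. (-1) ^ card (insert j U) * f (x \<otimes> finprod G s (insert j U)) * w (t + card (insert j U)))"
      using insert.hyps(2) by (subst sum.reindex) (auto intro!: inj_onI)
    also have "\<dots> = (\<Sum>U\<in>Pow J. - ((-1) ^ card U * f (x \<otimes> finprod G s U \<otimes> s j) * w (Suc t + card U)))"
    proof (rule sum.cong)
      fix U assume U: "U \<in> Pow J"
      then have "finite U" "j \<notin> U" "s \<in> U \<rightarrow> carrier G"
        using insert.hyps s finite_subset by auto
      then show "(-1) ^ card (insert j U) * f (x \<otimes> finprod G s (insert j U)) * w (t + card (insert j U))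
         = - ((-1) ^ card U * f (x \<otimes> finprod G s U \<otimes> s j) * w (Suc t + card U))"
        using sj insert.prems(5) by (simp add: m_ac)
    qed simp
    also have "F f w x t + \<dots> = F (\<lambda>y. f y - f (y \<otimes> s j)) w x t + F (\<lambda>y. f (y \<otimes> s j)) (fdiff w) x t"
      unfolding F_def fdiff_def sum_negf by (simp add: sum_subtractf algebra_simps)
    also have "int p dvd \<dots>"
    proof (rule dvd_add)
      show "int p dvd F (\<lambda>y. f y - f (y \<otimes> s j)) w x t"
        unfolding F_def
        using insert.prems insert.hyps sj ab by (intro insert.IH [of a' b]) auto
      show "int p dvd F (\<lambda>y. f (y \<otimes> s j)) (fdiff w) x t"
        unfolding F_def
      proof (intro insert.IH [of a b'])
        show "diff_vanish G p X a (\<lambda>y. f (y \<otimes> s j))"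
          using insert.prems sj assms(1) by (intro diff_vanish_translate)
        show "int p dvd (fdiff ^^ b') (fdiff w) t" for t
          using insert.prems(4) [of t] ab by (simp add: funpow_swap1)
      qed (use insert.prems insert.hyps ab in auto)
    qed
    finally show ?thesis .
  qed
qed

end

section \<open>Olson's theorem\<close>

lemma mset_conv_image_nth: "mset xs = image_mset ((!) xs) (mset_set {..<length xs})"
  by (metis atLeast_upt map_nth mset_map mset_set_upto_eq_mset_upto lessThan_atLeast0)

lemma image_nth_subseteq_mset:
  "U \<subseteq> {..<length xs} \<Longrightarrow> image_mset ((!) xs) (mset_set U) \<subseteq># mset xs"
  unfolding mset_conv_image_nth [of xs]
  by (intro image_mset_subseteq_mono subset_imp_msubset_mset_set) auto

lemma diff_vanish_mono: "Y \<subseteq> X \<Longrightarrow> diff_vanish G p X d f \<Longrightarrow> diff_vanish G p Y d f"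
  by (induction d arbitrary: f) auto

section \<open>Sums of sequences and the structure of abelian \<open>p\<close>-groups\<close>

context comm_group
begin

lemma seq_sum_superset:
  assumes "finite B" "set_mset S \<subseteq> B" "B \<subseteq> carrier G"
  shows "seq_sum G S = (\<Otimes>g\<in>B. g [^] count S g)"
  unfolding seq_sum_def using assms
  by (intro finprod_mono_neutral_cong_left) (auto simp: not_in_iff)

lemma seq_sum_empty [simp]: "seq_sum G {#} = \<one>"
  by (simp add: seq_sum_def)

lemma seq_sum_union:
  assumes "set_mset S \<subseteq> carrier G" "set_mset T \<subseteq> carrier G"
  shows "seq_sum G (S + T) = seq_sum G S \<otimes> seq_sum G T"
proof -
  let ?B = "set_mset S \<union> set_mset T"
  have "seq_sum G (S + T) = (\<Otimes>g\<in>?B. g [^] (count S g + count T g))"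
    by (simp add: seq_sum_def)
  also have "\<dots> = (\<Otimes>g\<in>?B. g [^] count S g \<otimes> g [^] count T g)"
    using assms by (intro finprod_cong') (auto simp: nat_pow_mult)
  also have "\<dots> = (\<Otimes>g\<in>?B. g [^] count S g) \<otimes> (\<Otimes>g\<in>?B. g [^] count T g)"
    using assms by (intro finprod_multf) auto
  also have "\<dots> = seq_sum G S \<otimes> seq_sum G T"
    using assms by (simp add: seq_sum_superset [of ?B])
  finally show ?thesis .
qed

lemma seq_sum_singleton [simp]: "x \<in> carrier G \<Longrightarrow> seq_sum G {#x#} = x"
  by (simp add: seq_sum_def)

lemma seq_sum_add_mset:
  "x \<in> carrier G \<Longrightarrow> set_mset S \<subseteq> carrier G \<Longrightarrow> seq_sum G (add_mset x S) = x \<otimes> seq_sum G S"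
  using seq_sum_union [of "{#x#}" S] by simp

lemma seq_sum_replicate_mset:
  assumes "x \<in> carrier G"
  shows "seq_sum G (replicate_mset n x) = x [^] n"
proof (induction n)
  case (Suc n)
  then show ?case
    using assms by (simp add: seq_sum_add_mset set_mset_replicate_mset_subset m_comm)
qed simp

lemma seq_sum_in_subgroup:
  assumes "subgroup H G" "set_mset S \<subseteq> H"
  shows "seq_sum G S \<in> H"
  using assms(2)
proof (induction S)
  case empty
  then show ?case
    using subgroup.one_closed [OF assms(1)] by simp
next
  case (add x S)
  then have "x \<in> H" "seq_sum G S \<in> H" "set_mset (add_mset x S) \<subseteq> carrier G"
    using subgroup.subset [OF assms(1)] by auto
  then show ?case
    using subgroup.m_closed [OF assms(1)] by (simp add: seq_sum_add_mset)
qed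

lemma seq_sum_image_mset:
  assumes "finite U" "s \<in> U \<rightarrow> carrier G"
  shows "seq_sum G (image_mset s (mset_set U)) = finprod G s U"
  using assms
proof (induction U)
  case (insert u U)
  then have "set_mset (image_mset s (mset_set U)) \<subseteq> carrier G"
    by auto
  with insert show ?case
    by (simp add: seq_sum_add_mset)
qed simp

lemma subgroup_nat_pow_closed:
  "subgroup H G \<Longrightarrow> h \<in> H \<Longrightarrow> h [^] (k :: nat) \<in> H"
  by (metis int_pow_int subgroup_int_pow_closed)

lemma subgroup_diff_closed:
  assumes "subgroup H G" "x \<in> H" "x \<otimes> y \<in> H" "y \<in> carrier G"
  shows "y \<in> H"
proof -
  have "x \<in> carrier G"
    using assms(1,2) by (rule subgroup.mem_carrier)
  then have "y = inv x \<otimes> (x \<otimes> y)"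
    using assms(4) by (simp add: m_assoc [symmetric])
  then show ?thesis
    using assms by (metis subgroup.m_closed subgroup.m_inv_closed)
qed

text \<open>A subgroup \<open>K\<close> that is maximal with trivial intersection with the cyclic group is a complement:
  otherwise some \<open>y\<close> outside the product has \<open>y\<^sup>p \<in> K\<close>, and \<open>K\<close> could be enlarged by \<open>y\<close>.\<close>

lemma p_group_complement:
  fixes p q j :: nat
  assumes "finite (carrier G)" "subgroup H G" "e \<in> H" "Factorial_Ring.prime p"
    and ord_e: "ord e = q" "q = p ^ j" and exp_H: "\<And>x. x \<in> H \<Longrightarrow> x [^] q = \<one>"
  obtains K where "subgroup K G" "K \<subseteq> H" "K \<inter> generate G {e} = {\<one>}" "H = K <#> generate G {e}"
proof -
  have HG: "H \<subseteq> carrier G"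
    using assms(2) by (rule subgroup.subset)
  then have eG: "e \<in> carrier G" and finH: "finite H"
    using assms(1,3) finite_subset by auto
  let ?E = "generate G {e}"
  have E: "subgroup ?E G" and e_in: "e \<in> ?E"
    using eG by (auto intro: generate_is_subgroup generate.incl)
  have EH: "?E \<subseteq> H"
    using assms(2,3) by (intro generate_subgroup_incl) auto
  let ?P = "\<lambda>K. subgroup K G \<and> K \<subseteq> H \<and> K \<inter> ?E = {\<one>}"
  have "?P {\<one>}"
    using triv_subgroup subgroup.one_closed [OF assms(2)] subgroup.one_closed [OF E] by auto
  moreover have "\<forall>K. ?P K \<longrightarrow> card K < Suc (card H)"
    using finH by (simp add: card_mono less_Suc_eq_le)
  ultimately have "\<exists>K. ?P K \<and> (\<forall>L. ?P L \<longrightarrow> card L \<le> card K)"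
    by (rule ex_has_greatest_nat)
  then obtain K where K: "subgroup K G" "K \<subseteq> H" "K \<inter> ?E = {\<one>}"
    and K_max: "\<forall>L. ?P L \<longrightarrow> card L \<le> card K"
    by (elim exE conjE)
  have KG: "K \<subseteq> carrier G"
    using K(1) by (rule subgroup.subset)
  let ?M = "K <#> ?E"
  have M: "subgroup ?M G"
    using K(1) E by (rule mult_subgroups)
  have one: "\<one> \<in> K" "\<one> \<in> ?E" "\<one> \<in> ?M"
    using K(1) E M by (auto intro: subgroup.one_closed)
  have KM: "K \<subseteq> ?M"
  proof
    fix k assume "k \<in> K"
    then have "k = k \<otimes> \<one>" "k \<in> K"
      using KG by auto
    then show "k \<in> ?M"
      using one(2) unfolding set_mult_def by blast
  qed
  have EM: "?E \<subseteq> ?M"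
  proof
    fix g assume "g \<in> ?E"
    then have "g = \<one> \<otimes> g" "g \<in> ?E"
      using HG EH by auto
    then show "g \<in> ?M"
      using one(1) unfolding set_mult_def by blast
  qed
  have "H \<subseteq> ?M"
  proof (rule ccontr)
    assume "\<not> H \<subseteq> ?M"
    then obtain x where x: "x \<in> H" "x \<notin> ?M"
      by auto
    then have xG: "x \<in> carrier G"
      using HG by auto
    \<comment> \<open>Minimality of \<open>i\<close> gives an element \<open>z\<close> outside
      \<open>?M\<close> whose \<open>p\<close>-th power lies in \<open>?M\<close>.\<close>
    define i where "i = (LEAST i. x [^] (p ^ i) \<in> ?M)"
    have "x [^] (p ^ j) \<in> ?M"
      using exp_H [OF x(1)] one ord_e by simp
    then have i: "x [^] (p ^ i) \<in> ?M"
      unfolding i_def by (rule LeastI)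
    have "i \<noteq> 0"
      using i x xG by (auto intro: ccontr)
    then obtain i' where i': "i = Suc i'"
      using not0_implies_Suc by blast
    define z where "z = x [^] (p ^ i')"
    have z: "z \<in> H" "z \<notin> ?M"
      using subgroup_nat_pow_closed [OF assms(2) x(1)] not_less_Least [of i' "\<lambda>i. x [^] (p ^ i) \<in> ?M"] i'
      by (auto simp: z_def i_def)
    then have zG: "z \<in> carrier G"
      using HG by auto
    have "z [^] p \<in> ?M"
      using i xG by (simp add: z_def i' nat_pow_pow mult.commute)
    then obtain k g where kg: "k \<in> K" "g \<in> ?E" "z [^] p = k \<otimes> g"
      unfolding set_mult_def by auto
    obtain a :: nat where a: "g = e [^] a"
      using kg(2) generate_pow_on_finite_carrier [OF assms(1) eG] by auto
    have kG: "k \<in> carrier G"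
      using kg KG by auto
    have "j \<noteq> 0"
    proof
      assume "j = 0"
      then have "z = \<one>"
        using exp_H [OF z(1)] ord_e zG by simp
      then show False
        using z one by simp
    qed
    then obtain j' where j': "j = Suc j'"
      using not0_implies_Suc by blast
    \<comment> \<open>Raising \<open>z [^] p = k \<otimes> e [^] a\<close> to the power
      \<open>p ^ j'\<close> yields the unit. So \<open>e [^] (a * p ^ j')\<close> lies in
      \<open>K\<close> and in \<open>?E\<close>, hence is trivial, and \<open>p\<close> divides
      \<open>a\<close>.\<close>
    have "\<one> = (z [^] p) [^] (p ^ j')"
      using exp_H [OF z(1)] ord_e zG j' by (simp add: nat_pow_pow)
    also have "\<dots> = k [^] (p ^ j') \<otimes> e [^] (a * p ^ j')"
      using kg(3) a kG eG by (simp add: nat_pow_distrib nat_pow_pow)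
    finally have "k [^] (p ^ j') \<otimes> e [^] (a * p ^ j') \<in> K"
      using one by simp
    then have "e [^] (a * p ^ j') \<in> K"
      using subgroup_diff_closed [OF K(1) subgroup_nat_pow_closed [OF K(1) kg(1)]] eG by blast
    moreover have "e [^] (a * p ^ j') \<in> ?E"
      using subgroup_nat_pow_closed [OF E e_in] .
    ultimately have "e [^] (a * p ^ j') = \<one>"
      using K(3) by blast
    then have "p * p ^ j' dvd a * p ^ j'"
      using pow_eq_id [OF eG] ord_e j' by simp
    then have "p dvd a"
      using assms(4) by (simp add: prime_gt_0_nat)
    then obtain b where b: "a = p * b" ..
    \<comment> \<open>Dividing out the \<open>p\<close>-th root \<open>e [^] b\<close> of
      \<open>g\<close> leaves \<open>y [^] p = k\<close> in \<open>K\<close>, while \<open>y\<close>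
      stays outside \<open>?M\<close>.\<close>
    define y where "y = z \<otimes> inv (e [^] b)"
    have ebG: "e [^] b \<in> carrier G" and ebE: "e [^] b \<in> ?E"
      using eG subgroup_nat_pow_closed [OF E e_in] by auto
    have y: "y \<in> H"
      unfolding y_def using z(1) ebE EH assms(2)
      by (meson subgroup.m_closed subgroup.m_inv_closed subsetD)
    then have yG: "y \<in> carrier G"
      using HG by auto
    have yM: "y \<notin> ?M"
    proof
      assume "y \<in> ?M"
      then have "y \<otimes> e [^] b \<in> ?M"
        using ebE EM M by (meson subgroup.m_closed subsetD)
      then show False
        using z(2) zG ebG by (simp add: y_def m_assoc)
    qed
    have "y [^] p = z [^] p \<otimes> inv (e [^] a)"
      using zG ebG eG by (simp add: y_def nat_pow_distrib nat_pow_inv nat_pow_pow b mult.commute)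
    then have yp: "y [^] p = k"
      using kg(3) a kG eG by (simp add: m_assoc)
    let ?Y = "generate G {y}" and ?L = "K <#> generate G {y}"
    have Y: "subgroup ?Y G" "y \<in> ?Y"
      using yG by (auto intro: generate_is_subgroup generate.incl)
    have YH: "?Y \<subseteq> H"
      using y assms(2) by (intro generate_subgroup_incl) auto
    have L: "subgroup ?L G"
      using K(1) Y(1) by (rule mult_subgroups)
    have LH: "?L \<subseteq> H"
      using K(2) YH subgroup.m_closed [OF assms(2)] unfolding set_mult_def by auto
    have "y = \<one> \<otimes> y"
      using yG by simp
    then have "y \<in> ?L"
      using one(1) Y(2) unfolding set_mult_def by blast
    moreover have "K \<subseteq> ?L"
    proof
      fix k assume "k \<in> K"
      then have "k = k \<otimes> \<one>" "k \<in> K"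
        using KG by auto
      then show "k \<in> ?L"
        using subgroup.one_closed [OF Y(1)] unfolding set_mult_def by blast
    qed
    ultimately have "K \<subset> ?L"
      using yM KM by auto
    then have "card K < card ?L"
      using finite_subset [OF LH finH] by (simp add: psubset_card_mono)
    then have "?L \<inter> ?E \<noteq> {\<one>}"
      using K_max [rule_format, of ?L] L LH by auto
    moreover have "\<one> \<in> ?L \<inter> ?E"
      using L one by (auto intro: subgroup.one_closed)
    ultimately obtain g' where g': "g' \<in> ?L" "g' \<in> ?E" "g' \<noteq> \<one>"
      by auto
    then obtain k' w where k': "k' \<in> K" "w \<in> ?Y" "g' = k' \<otimes> w"
      unfolding set_mult_def by auto
    then obtain l :: nat where l: "w = y [^] l"
      using generate_pow_on_finite_carrier [OF assms(1) yG] by auto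
    have ylM: "y [^] l \<in> ?M"
    proof (rule subgroup_diff_closed [OF M])
      show "k' \<in> ?M" "k' \<otimes> y [^] l \<in> ?M"
        using k' l KM EM g' by auto
    qed (use yG in simp)
    show False
    proof (cases "p dvd l")
      case True
      then obtain r where "l = p * r" ..
      then have "y [^] l = k [^] r"
        using yp yG by (simp add: nat_pow_pow [symmetric])
      then have "y [^] l \<in> K"
        using subgroup_nat_pow_closed [OF K(1) kg(1)] by simp
      then have "g' \<in> K"
        using k' l subgroup.m_closed [OF K(1)] by simp
      then show False
        using g' K(3) by blast
    next
      case False
      then have "coprime l p"
        using assms(4) by (metis coprime_commute prime_imp_coprime)
      moreover have "p \<noteq> 1"
        using assms(4) by auto
      \<comment> \<open>As \<open>y [^] p\<close> and \<open>y [^] l\<close> both lie in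
        \<open>?M\<close>, Bezout puts \<open>y\<close> itself there.\<close>
      ultimately obtain u v where uv: "l * u = p * v + 1"
        using coprime_bezout_strong by blast
      have "y [^] (p * v) \<in> ?M"
        using subgroup_nat_pow_closed [OF M, of k v] KM kg(1) yp yG by (auto simp: nat_pow_pow [symmetric])
      moreover have "y [^] (l * u) \<in> ?M"
        using subgroup_nat_pow_closed [OF M ylM, of u] yG by (simp add: nat_pow_pow)
      then have "y [^] (p * v) \<otimes> y \<in> ?M"
        using uv by simp
      ultimately have "y \<in> ?M"
        using subgroup_diff_closed [OF M] yG by blast
      then show False
        using yM by simp
    qed
  qed
  moreover have "?M \<subseteq> H"
    using K(2) EH subgroup.m_closed [OF assms(2)] unfolding set_mult_def by auto
  ultimately show thesis
    using K that by blast
qed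

text \<open>By induction a cyclic factor of maximal order \<open>q\<close> is split off and
  \<open>q - 1\<close> copies of its generator are appended. This keeps the sequence zero-sum free
  and raises the order of vanishing by \<open>q - 1\<close>.\<close>

lemma zero_sum_free_diff_vanish:
  fixes p n :: nat
  assumes "finite (carrier G)" "Factorial_Ring.prime p" "odd p" "order G = p ^ n" "subgroup H G"
  shows "\<exists>S. set_mset S \<subseteq> H \<and> (\<forall>T. T \<subseteq># S \<longrightarrow> T \<noteq> {#} \<longrightarrow> seq_sum G T \<noteq> \<one>) \<and>
    (\<forall>f. diff_vanish G p H (Suc (size S)) f)"
  using assms(5)
proof (induction "card H" arbitrary: H rule: less_induct)
  case less
  note H = less.prems
  have HG: "H \<subseteq> carrier G"
    using H by (rule subgroup.subset)
  have oneH: "\<one> \<in> H"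
    using H by (rule subgroup.one_closed)
  have finH: "finite H"
    using HG assms(1) by (rule finite_subset)
  have ord_pow: "\<exists>i. ord x = p ^ i" if "x \<in> H" for x
    using ord_dvd_group_order [of x] that HG assms(2,4) by (auto simp: divides_primepow_nat)
  show ?case
  proof (cases "H = {\<one>}")
    case True
    then show ?thesis
      by (intro exI [of _ "{#}"] conjI allI) simp_all
  next
    case False
    obtain e where e: "e \<in> H" and e_max: "\<And>x. x \<in> H \<Longrightarrow> ord x \<le> ord e"
    proof -
      have "\<forall>x. x \<in> H \<longrightarrow> ord x < Suc (order G)"
        using HG assms(1) ord_le_group_order by (auto simp: less_Suc_eq_le)
      with oneH have "\<exists>x. x \<in> H \<and> (\<forall>y. y \<in> H \<longrightarrow> ord y \<le> ord x)"
        by (rule ex_has_greatest_nat)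
      then show thesis
        using that by blast
    qed
    then obtain j where j: "ord e = p ^ j"
      using ord_pow by blast
    have eG: "e \<in> carrier G"
      using e HG by auto
    define q where "q = p ^ j"
    \<comment> \<open>All orders are powers of \<open>p\<close>, so each of them divides the largest
      one.\<close>
    have exp_H: "x [^] q = \<one>" if x: "x \<in> H" for x
    proof -
      obtain i where i: "ord x = p ^ i"
        using ord_pow [OF x] by blast
      then have "p ^ i \<le> p ^ j"
        using e_max [OF x] j by simp
      then have "p ^ i dvd p ^ j"
        using prime_gt_1_nat [OF assms(2)] by (simp add: le_imp_power_dvd)
      then show ?thesis
        using pow_eq_id [of x] x HG i by (auto simp: q_def)
    qed
    have ord_e: "ord e = q"
      using j q_def by simp
    obtain K where K: "subgroup K G" "K \<subseteq> H" "K \<inter> generate G {e} = {\<one>}" "H = K <#> generate G {e}"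
      using p_group_complement [OF assms(1) H e assms(2) ord_e q_def exp_H] by blast
    have e_in: "e \<in> generate G {e}"
      by (simp add: generate.incl)
    have "e \<noteq> \<one>"
    proof
      assume "e = \<one>"
      then have "q = 1"
        using ord_e by simp
      then have "x = \<one>" if "x \<in> H" for x
        using exp_H [OF that] subsetD [OF HG that] by simp
      then show False
        using False oneH by blast
    qed
    then have "K \<subset> H"
      using K e e_in by blast
    then have "card K < card H"
      using finH by (simp add: psubset_card_mono)
    then obtain S where S: "set_mset S \<subseteq> K" "\<And>T. T \<subseteq># S \<Longrightarrow> T \<noteq> {#} \<Longrightarrow> seq_sum G T \<noteq> \<one>"
      "\<And>f. diff_vanish G p K (Suc (size S)) f"
      using less.hyps K(1) by blast
    have q_pos: "0 < q"
      using assms(2) by (simp add: q_def prime_gt_0_nat)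
    have KG: "K \<subseteq> carrier G"
      using K(1) by (rule subgroup.subset)
    define S' where "S' = S + replicate_mset (q - 1) e"
    have "set_mset S' \<subseteq> H"
      using S(1) K(2) e by (auto simp: S'_def)
    moreover have "seq_sum G T \<noteq> \<one>" if T: "T \<subseteq># S'" "T \<noteq> {#}" for T
    proof
      assume T0: "seq_sum G T = \<one>"
      \<comment> \<open>\<open>T\<close> separates into a part over \<open>K\<close> and copies of
        \<open>e\<close>. As \<open>K\<close> meets the cyclic group trivially, a zero sum makes the
        power of \<open>e\<close> trivial; fewer than \<open>q\<close> copies then means
        none.\<close>
      define T1 where "T1 = T \<inter># S"
      have T1: "T1 \<subseteq># S"
        by (simp add: T1_def)
      have T_split: "T = T1 + (T - T1)"
        unfolding T1_def by (metis subset_mset.add_diff_inverse subset_mset.inf_le1)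
      have "T - T1 \<subseteq># replicate_mset (q - 1) e"
        using T(1) by (simp add: T1_def S'_def subset_eq_diff_conv add.commute)
      then obtain i where i: "i \<le> q - 1" "T - T1 = replicate_mset i e"
        by (metis msubseteq_replicate_msetE)
      have T1K: "set_mset T1 \<subseteq> K"
        using T1 S(1) set_mset_mono by blast
      then have "seq_sum G T = seq_sum G T1 \<otimes> e [^] i"
        using T_split i(2) KG eG seq_sum_union [of T1 "T - T1"]
        by (auto simp: seq_sum_replicate_mset subset_iff)
      moreover have T1_in: "seq_sum G T1 \<in> K"
        using K(1) T1K by (rule seq_sum_in_subgroup)
      ultimately have "e [^] i \<in> K"
        using subgroup_diff_closed [OF K(1) T1_in, of "e [^] i"] T0 subgroup.one_closed [OF K(1)] eG by simp
      moreover have "e [^] i \<in> generate G {e}"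
        using eG e_in generate_is_subgroup [of "{e}"] by (auto intro: subgroup_nat_pow_closed)
      ultimately have "e [^] i = \<one>"
        using K(3) by blast
      then have "q dvd i"
        using pow_eq_id [OF eG] ord_e by simp
      then have "i = 0"
        using i(1) q_pos by (auto dest: dvd_imp_le)
      then have "T = T1"
        using T_split i(2) by simp
      then show False
        using S(2) [OF T1] T T0 by simp
    qed
    moreover have "diff_vanish G p H (Suc (size S')) f" for f
    proof -
      \<comment> \<open>The orders combine without loss:
        \<open>Suc (size S) + q - 1 = Suc (size S')\<close>.\<close>
      have "diff_vanish G p (K \<union> {e}) (Suc (size S')) f"
        using diff_vanish_singleton_prime_power [OF eG assms(2,3)] exp_H [OF e] q_pos KG eG S(3)
        by (intro diff_vanish_Un [of K "{e}" p "Suc (size S)" f q]) (auto simp: S'_def q_def)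
      then have "diff_vanish G p (generate G (K \<union> {e})) (Suc (size S')) f"
        using KG eG by (intro diff_vanish_generate) auto
      moreover have "H \<subseteq> generate G (K \<union> {e})"
      proof
        fix x assume "x \<in> H"
        then obtain k g where "k \<in> K" "g \<in> generate G {e}" "x = k \<otimes> g"
          using K(4) unfolding set_mult_def by auto
        moreover have "generate G {e} \<subseteq> generate G (K \<union> {e})"
          by (intro mono_generate) auto
        ultimately show "x \<in> generate G (K \<union> {e})"
          by (auto intro: generate.eng generate.incl)
      qed
      ultimately show ?thesis
        by (rule diff_vanish_mono [rotated])
    qed
    ultimately show ?thesis
      by blast
  qed
qed

text \<open>Olson's theorem: the power \<open>D(G)\<close> of the augmentation ideal vanishes.\<close>

lemma diff_vanish_davenport_constant:
  fixes p n :: nat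
  assumes "finite (carrier G)" "Factorial_Ring.prime p" "odd p" "order G = p ^ n"
  shows "diff_vanish G p (carrier G) (davenport_constant G) f"
proof -
  obtain S where S: "set_mset S \<subseteq> carrier G" "\<And>T. T \<subseteq># S \<Longrightarrow> T \<noteq> {#} \<Longrightarrow> seq_sum G T \<noteq> \<one>"
    "\<And>f. diff_vanish G p (carrier G) (Suc (size S)) f"
    using zero_sum_free_diff_vanish [OF assms subgroup_self] by blast
  let ?P = "\<lambda>N. 0 < N \<and> (\<forall>S. sequence_over G S \<and> N \<le> size S \<longrightarrow>
    (\<exists>T. T \<subseteq># S \<and> T \<noteq> {#} \<and> seq_sum G T = \<one>))"
  have "?P (Suc (size S))"
  proof (intro conjI allI impI; (elim conjE)?)
    fix R assume R: "sequence_over G R" "Suc (size S) \<le> size R"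
    obtain xs where xs: "R = mset xs"
      by (metis ex_mset)
    let ?J = "{..<length xs}" and ?s = "(!) xs" and ?f = "\<lambda>x. of_bool (x = \<one>) :: int"
    have s: "?s j \<in> carrier G" if "j \<in> ?J" for j
      using R(1) xs that by (auto simp: sequence_over_def subset_iff)
    \<comment> \<open>Constant weights are killed by one difference, whence \<open>b = 1\<close>.
      Without a nonempty zero-sum subset only the empty set contributes, and the sum would be
      1.\<close>
    have dvd: "int p dvd (\<Sum>U\<in>Pow ?J. (-1) ^ card U * ?f (\<one> \<otimes> finprod G ?s U) * (\<lambda>_. 1) (0 + card U))"
      using R(2) xs s S(3) [of ?f] by (intro dvd_weighted_subset_sum
          [where a = "Suc (size S)" and b = 1 and X = "carrier G"]) (simp_all add: fdiff_def)
    have one: "(\<Sum>U\<in>Pow ?J. (-1) ^ card U * ?f (\<one> \<otimes> finprod G ?s U) * (\<lambda>_. 1) (0 + card U)) = 1"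
      if none: "\<not> (\<exists>U\<subseteq>?J. U \<noteq> {} \<and> finprod G ?s U = \<one>)"
    proof -
      have "(\<Sum>U\<in>Pow ?J. (-1) ^ card U * ?f (\<one> \<otimes> finprod G ?s U) * (\<lambda>_. 1) (0 + card U))
        = (\<Sum>U\<in>Pow ?J. if U = {} then 1 else 0)"
      proof (rule sum.cong)
        fix U assume U: "U \<in> Pow ?J"
        then have "finprod G ?s U \<in> carrier G"
          using s by (intro finprod_closed) auto
        then show "(-1) ^ card U * ?f (\<one> \<otimes> finprod G ?s U) * (\<lambda>_. 1) (0 + card U) = (if U = {} then 1 else 0)"
          using none U by auto
      qed simp
      then show ?thesis
        by simp
    qed
    have "\<exists>U\<subseteq>?J. U \<noteq> {} \<and> finprod G ?s U = \<one>"
    proof (rule ccontr)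
      assume "\<not> (\<exists>U\<subseteq>?J. U \<noteq> {} \<and> finprod G ?s U = \<one>)"
      from dvd [unfolded one [OF this]] show False
        using prime_gt_1_nat [OF assms(2)] by simp
    qed
    then obtain U where U: "U \<subseteq> ?J" "U \<noteq> {}" "finprod G ?s U = \<one>"
      by blast
    have finU: "finite U"
      using U(1) finite_subset by blast
    let ?T = "image_mset ?s (mset_set U)"
    have "?T \<subseteq># R" "?T \<noteq> {#}"
      using U finU xs by (auto simp: image_nth_subseteq_mset mset_set_empty_iff)
    moreover have "seq_sum G ?T = \<one>"
      using U finU s by (subst seq_sum_image_mset) auto
    ultimately show "\<exists>T. T \<subseteq># R \<and> T \<noteq> {#} \<and> seq_sum G T = \<one>"
      by blast
  qed simp
  then have le: "davenport_constant G \<le> Suc (size S)" and D: "?P (davenport_constant G)"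
    unfolding davenport_constant_def by (rule Least_le, rule LeastI)
  \<comment> \<open>The zero-sum free \<open>S\<close> is itself the lower bound.\<close>
  have "\<not> davenport_constant G \<le> size S"
    using D S(1,2) unfolding sequence_over_def by blast
  with le have "davenport_constant G = Suc (size S)"
    by simp
  then show ?thesis
    using S(3) by simp
qed

lemma group_exponent_pos_pow:
  assumes "finite (carrier G)"
  shows "0 < group_exponent G \<and> (\<forall>g\<in>carrier G. g [^] group_exponent G = \<one>)"
  unfolding group_exponent_def
  using assms pow_order_eq_1 order_gt_0_iff_finite
  by (intro LeastI [of "\<lambda>n. 0 < n \<and> (\<forall>g\<in>carrier G. g [^] n = \<one>)" "order G"]) auto

text \<open>The remainder of the order modulo the exponent also annihilates every element, so
  minimality forces it to be 0.\<close>

lemma group_exponent_dvd_order: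
  assumes "finite (carrier G)"
  shows "group_exponent G dvd order G"
proof -
  let ?n = "group_exponent G"
  have n: "0 < ?n" "\<And>g. g \<in> carrier G \<Longrightarrow> g [^] ?n = \<one>"
    using group_exponent_pos_pow [OF assms] by auto
  have "g [^] (order G mod ?n) = \<one>" if "g \<in> carrier G" for g
  proof -
    have "ord g dvd order G" "ord g dvd ?n"
      using that n(2) ord_dvd_group_order pow_eq_id by auto
    then show ?thesis
      using that by (simp add: pow_eq_id dvd_mod)
  qed
  moreover have "order G mod ?n < ?n"
    using n(1) by simp
  ultimately have "order G mod ?n = 0"
    using not_less_Least [of "order G mod ?n" "\<lambda>n. 0 < n \<and> (\<forall>g\<in>carrier G. g [^] n = \<one>)"]
    unfolding group_exponent_def by fastforce
  then show ?thesis
    by auto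
qed

end

section \<open>Counting zero-sum subsequences\<close>

lemma funpow_fdiff_diff: "(fdiff ^^ n) (\<lambda>t. u t - w t) = (\<lambda>t. (fdiff ^^ n) u t - (fdiff ^^ n) w t)"
  by (intro ext) (simp add: funpow_fdiff sum_subtractf [symmetric] right_diff_distrib)

lemma dvd_funpow_fdiff_periodic:
  assumes "Factorial_Ring.prime p" "odd p" "\<And>t. w (t + p ^ k) = w t"
  shows "int p dvd (fdiff ^^ (p ^ k)) w t"
  using funpow_fdiff_prime_power [OF assms(1,2), of k w t] assms(3) by simp

text \<open>One application of \<open>(1 - E)^q\<close> turns \<open>w\<close> into
  \<open>- v\<close> modulo \<open>p\<close>; a second one kills the periodic
  \<open>v\<close>.\<close>

lemma dvd_funpow_fdiff_quasiperiodic: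
  assumes "Factorial_Ring.prime p" "odd p" "\<And>t. w (t + p ^ k) = w t + v t" "\<And>t. v (t + p ^ k) = v t"
  shows "int p dvd (fdiff ^^ (2 * p ^ k)) w t"
proof -
  define q where "q = p ^ k"
  have "int p dvd (fdiff ^^ q) w t - - v t" for t
    using funpow_fdiff_prime_power [OF assms(1,2), of k w t] assms(3) by (simp add: q_def)
  then have "int p dvd (fdiff ^^ q) ((fdiff ^^ q) w) t - (fdiff ^^ q) (\<lambda>t. - v t) t"
    by (rule funpow_fdiff_cong)
  moreover have "int p dvd (fdiff ^^ q) (\<lambda>t. - v t) t"
    using assms unfolding q_def by (intro dvd_funpow_fdiff_periodic) auto
  ultimately have "int p dvd ((fdiff ^^ q) ((fdiff ^^ q) w) t - (fdiff ^^ q) (\<lambda>t. - v t) t)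
      + (fdiff ^^ q) (\<lambda>t. - v t) t"
    by (rule dvd_add)
  then have "int p dvd (fdiff ^^ q) ((fdiff ^^ q) w) t"
    by simp
  then show ?thesis
    by (simp add: q_def mult_2 funpow_add)
qed

text \<open>\<open>A i\<close> is the sequence of differences of order \<open>i\<close> of \<open>A 0\<close>.\<close>

lemma differences_vanish:
  fixes A :: "nat \<Rightarrow> nat \<Rightarrow> int" and d :: int
  assumes step: "\<And>i r. 0 < r \<Longrightarrow> r < q \<Longrightarrow> A (Suc i) r = A i r - A i (r - 1)"
    and top: "\<And>r. r < q \<Longrightarrow> d dvd A (Suc h) r"
    and window: "\<And>r. a \<le> r \<Longrightarrow> r \<le> a + h \<Longrightarrow> d dvd A 0 r"
    and "a + h < q" "r < q"
  shows "d dvd A 0 r"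
proof -
  \<comment> \<open>Each difference costs the leftmost place of the window.\<close>
  have win: "d dvd A i r" if "a + i \<le> r" "r \<le> a + h" for i r
    using that
  proof (induction i arbitrary: r)
    case 0
    then show ?case
      using window by simp
  next
    case (Suc i)
    then have "d dvd A i r" "d dvd A i (r - 1)"
      by auto
    then show ?case
      using step [of r i] Suc.prems assms(4) by auto
  qed
  \<comment> \<open>Downward in \<open>i\<close>: once the differences of order \<open>i + 1\<close>
    vanish on the whole range, those of order \<open>i\<close> are constant there, and the place
    \<open>a + h\<close> shows the constant to be 0.\<close>
  have "\<forall>r<q. d dvd A i r" if "i \<le> Suc h" for i
    using that
  proof (induction i rule: inc_induct)
    case base
    then show ?case
      using top by simp
  next
    case (step i)
    have eq: "d dvd A i r - A i 0" if "r < q" for r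
      using that
    proof (induction r)
      case (Suc r)
      then have "d dvd A (Suc i) (Suc r)" "A (Suc i) (Suc r) = A i (Suc r) - A i r"
        using step.IH assms(1) [of "Suc r" i] by auto
      then have "d dvd (A i (Suc r) - A i r) + (A i r - A i 0)"
        using Suc by (intro dvd_add) auto
      then show ?case
        by simp
    qed simp
    have "d dvd A i (a + h)"
      using win [of i "a + h"] step.hyps by auto
    then have "d dvd A i (a + h) - (A i (a + h) - A i 0)"
      using eq [OF assms(4)] by (rule dvd_diff)
    then have "d dvd A i 0"
      by simp
    then have "d dvd (A i r - A i 0) + A i 0" if "r < q" for r
      using eq [OF that] by (intro dvd_add)
    then show ?case
      by simp
  qed
  then show ?thesis
    using assms(5) by blast
qed

lemma sum_residue_class:
  fixes f :: "nat \<Rightarrow> int"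
  assumes "r < q" "\<And>l. l mod q \<noteq> r \<Longrightarrow> f l = 0"
  shows "(\<Sum>l<4 * q. f l) = f r + f (q + r) + f (2 * q + r) + f (3 * q + r)"
proof -
  have "(\<Sum>l<4 * q. f l) = sum f {r, q + r, 2 * q + r, 3 * q + r}"
  proof (rule sum.mono_neutral_right)
    show "{r, q + r, 2 * q + r, 3 * q + r} \<subseteq> {..<4 * q}"
      using assms(1) by auto
    show "\<forall>l\<in>{..<4 * q} - {r, q + r, 2 * q + r, 3 * q + r}. f l = 0"
    proof
      fix l assume l: "l \<in> {..<4 * q} - {r, q + r, 2 * q + r, 3 * q + r}"
      have "l mod q \<noteq> r"
      proof
        assume "l mod q = r"
        then obtain d where d: "l = q * d + r"
          by (metis mult_div_mod_eq)
        then have "q * d + r < 4 * q"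
          using l by simp
        then have "q * d < q * 4"
          by linarith
        then have "d < 4"
          by (simp only: mult_less_cancel1)
        then have "d = 0 \<or> d = 1 \<or> d = 2 \<or> d = 3"
          by linarith
        then show False
          using l d by auto
      qed
      then show "f l = 0"
        by (rule assms(2))
    qed
  qed simp
  also have "\<dots> = f r + f (q + r) + f (2 * q + r) + f (3 * q + r)"
    using assms(1) by simp
  finally show ?thesis .
qed

text \<open>Index sets replace sub-multisets so that equal terms at different positions are counted
  separately.\<close>

definition zero_sum_subsets ::
  "('a, 'b) monoid_scheme \<Rightarrow> ('i \<Rightarrow> 'a) \<Rightarrow> 'i set \<Rightarrow> nat \<Rightarrow> 'i set set" where
  "zero_sum_subsets G s J l = {U. U \<subseteq> J \<and> card U = l \<and> finprod G s U = \<one>\<^bsub>G\<^esub>}"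

section \<open>Zero-sum index sets of prescribed length\<close>

context comm_group
begin

lemma finite_zero_sum_subsets: "finite J \<Longrightarrow> finite (zero_sum_subsets G s J l)"
  by (rule finite_subset [of _ "Pow J"]) (auto simp: zero_sum_subsets_def)

lemma zero_sum_subsets_0: "finite J \<Longrightarrow> zero_sum_subsets G s J 0 = {{}}"
  by (auto simp: zero_sum_subsets_def dest: finite_subset)

lemma zero_sum_subsets_empty:
  assumes "finite J" "card J < l"
  shows "zero_sum_subsets G s J l = {}"
proof -
  have "card U < l" if "U \<subseteq> J" for U
    using card_mono [OF assms(1) that] assms(2) by simp
  then show ?thesis
    by (auto simp: zero_sum_subsets_def)
qed

lemma zero_sum_subsets_Un:
  assumes "finite I" "s \<in> I \<rightarrow> carrier G" "A \<in> zero_sum_subsets G s I k"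
    "C \<in> zero_sum_subsets G s (I - A) l"
  shows "A \<union> C \<in> zero_sum_subsets G s I (k + l)"
proof -
  have AC: "A \<subseteq> I" "C \<subseteq> I" "A \<inter> C = {}"
    using assms(3,4) by (auto simp: zero_sum_subsets_def)
  then have "finite A" "finite C" "s \<in> A \<rightarrow> carrier G" "s \<in> C \<rightarrow> carrier G"
    using assms(1,2) finite_subset by (blast, blast, auto)
  then show ?thesis
    using assms(3,4) AC by (auto simp: zero_sum_subsets_def finprod_Un_disjoint card_Un_disjoint)
qed

lemma zero_sum_subsets_Diff:
  assumes "finite E" "s \<in> E \<rightarrow> carrier G" "finprod G s E = \<one>" "C \<in> zero_sum_subsets G s E l"
  shows "E - C \<in> zero_sum_subsets G s E (card E - l)"
proof -
  have C: "C \<subseteq> E" "card C = l" "finprod G s C = \<one>" "finite C"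
    using assms(1,4) finite_subset by (auto simp: zero_sum_subsets_def)
  have "s \<in> (E - C) \<rightarrow> carrier G" "s \<in> C \<rightarrow> carrier G"
    using assms(2) C(1) by auto
  then have "finprod G s ((E - C) \<union> C) = finprod G s (E - C) \<otimes> finprod G s C"
    using assms(1) C(4) by (intro finprod_Un_disjoint) auto
  moreover have "(E - C) \<union> C = E"
    using C(1) by auto
  ultimately have "finprod G s (E - C) = \<one>"
    using assms(3) C(3) \<open>s \<in> (E - C) \<rightarrow> carrier G\<close> by simp
  then show ?thesis
    using C by (auto simp: zero_sum_subsets_def card_Diff_subset)
qed

text \<open>Dual form of divisibility by \<open>(1 - z)^b\<close>: the coefficients pair to zero
  with every weight killed by \<open>b\<close> differences.\<close>

lemma dvd_zero_sum_count:
  assumes "finite J" "s \<in> J \<rightarrow> carrier G" "\<And>f. diff_vanish G p (carrier G) D f"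
    and "D + b \<le> Suc (card J)" "\<And>t. int p dvd (fdiff ^^ b) w t" "card J < n"
  shows "int p dvd (\<Sum>l<n. (-1) ^ l * int (card (zero_sum_subsets G s J l)) * w l)"
proof -
  let ?f = "\<lambda>x. of_bool (x = \<one>) :: int"
  let ?g = "\<lambda>U. (-1) ^ card U * ?f (finprod G s U) * w (card U)"
  have "int p dvd (\<Sum>U\<in>Pow J. (-1) ^ card U * ?f (\<one> \<otimes> finprod G s U) * w (0 + card U))"
    by (rule dvd_weighted_subset_sum [where X = "carrier G" and a = D and b = b]) (use assms in auto)
  also have "(\<Sum>U\<in>Pow J. (-1) ^ card U * ?f (\<one> \<otimes> finprod G s U) * w (0 + card U)) = sum ?g (Pow J)"
  proof (rule sum.cong)
    fix U assume "U \<in> Pow J"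
    then have "finprod G s U \<in> carrier G"
      using assms(2) by (intro finprod_closed) auto
    then show "(-1) ^ card U * ?f (\<one> \<otimes> finprod G s U) * w (0 + card U) = ?g U"
      by simp
  qed simp
  also have "\<dots> = (\<Sum>l<n. sum ?g {U \<in> Pow J. card U = l})"
    using assms(1,6) by (intro sum.group [symmetric]) (auto intro: le_less_trans [OF card_mono])
  also have "\<dots> = (\<Sum>l<n. (-1) ^ l * int (card (zero_sum_subsets G s J l)) * w l)"
  proof (rule sum.cong)
    fix l
    have "sum ?g {U \<in> Pow J. card U = l}
        = (-1) ^ l * w l * (\<Sum>U\<in>{U \<in> Pow J. card U = l}. ?f (finprod G s U))"
      by (auto simp: sum_distrib_left intro!: sum.cong)
    also have "(\<Sum>U\<in>{U \<in> Pow J. card U = l}. ?f (finprod G s U))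
        = int (card ({U \<in> Pow J. card U = l} \<inter> {U. finprod G s U = \<one>}))"
      using assms(1) by (subst sum_of_bool_eq) auto
    also have "{U \<in> Pow J. card U = l} \<inter> {U. finprod G s U = \<one>} = zero_sum_subsets G s J l"
      by (auto simp: zero_sum_subsets_def)
    finally show "sum ?g {U \<in> Pow J. card U = l}
        = (-1) ^ l * int (card (zero_sum_subsets G s J l)) * w l"
      by simp
  qed simp
  finally show ?thesis .
qed

text \<open>Disjoint zero-sum pairs \<open>(A, C)\<close> correspond to the pairs
  \<open>(A \<union> C, C)\<close>.\<close>

lemma card_zero_sum_pairs:
  assumes "finite I" "s \<in> I \<rightarrow> carrier G"
  shows "(\<Sum>A\<in>zero_sum_subsets G s I k. card (zero_sum_subsets G s (I - A) l))
       = (\<Sum>E\<in>zero_sum_subsets G s I (k + l). card (zero_sum_subsets G s E l))"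
proof -
  let ?Z = "zero_sum_subsets G s"
  have fin: "finite (?Z J i)" if "J \<subseteq> I" for J i
    using finite_zero_sum_subsets assms(1) that finite_subset by blast
  have sub: "E \<subseteq> I" "s \<in> E \<rightarrow> carrier G" "finite E" if "E \<in> ?Z I i" for E i
    using that assms finite_subset by (auto simp: zero_sum_subsets_def)
  have "bij_betw (\<lambda>(A, C). (A \<union> C, C)) (Sigma (?Z I k) (\<lambda>A. ?Z (I - A) l))
      (Sigma (?Z I (k + l)) (\<lambda>E. ?Z E l))"
  proof (rule bij_betw_byWitness [where f' = "\<lambda>(E, C). (E - C, C)"])
    show "\<forall>x\<in>Sigma (?Z I k) (\<lambda>A. ?Z (I - A) l).
        (\<lambda>(E, C). (E - C, C)) ((\<lambda>(A, C). (A \<union> C, C)) x) = x"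
      by (auto simp: zero_sum_subsets_def)
    show "\<forall>x\<in>Sigma (?Z I (k + l)) (\<lambda>E. ?Z E l).
        (\<lambda>(A, C). (A \<union> C, C)) ((\<lambda>(E, C). (E - C, C)) x) = x"
      by (auto simp: zero_sum_subsets_def)
    show "(\<lambda>(A, C). (A \<union> C, C)) ` Sigma (?Z I k) (\<lambda>A. ?Z (I - A) l)
        \<subseteq> Sigma (?Z I (k + l)) (\<lambda>E. ?Z E l)"
    proof clarify
      fix A C assume AC: "A \<in> ?Z I k" "C \<in> ?Z (I - A) l"
      then have "C \<in> ?Z (A \<union> C) l"
        by (auto simp: zero_sum_subsets_def)
      then show "A \<union> C \<in> ?Z I (k + l) \<and> C \<in> ?Z (A \<union> C) l"
        using zero_sum_subsets_Un [OF assms AC] by simp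
    qed
    show "(\<lambda>(E, C). (E - C, C)) ` Sigma (?Z I (k + l)) (\<lambda>E. ?Z E l)
        \<subseteq> Sigma (?Z I k) (\<lambda>A. ?Z (I - A) l)"
    proof clarify
      fix E C assume EC: "E \<in> ?Z I (k + l)" "C \<in> ?Z E l"
      have "card E = k + l" "finprod G s E = \<one>"
        using EC(1) by (auto simp: zero_sum_subsets_def)
      then have "E - C \<in> ?Z E k"
        using zero_sum_subsets_Diff [OF sub(3,2) [OF EC(1)] _ EC(2)] EC(1) by simp
      then show "E - C \<in> ?Z I k \<and> C \<in> ?Z (I - (E - C)) l"
        using EC sub(1) [OF EC(1)] by (auto simp: zero_sum_subsets_def)
    qed
  qed
  then have "card (Sigma (?Z I k) (\<lambda>A. ?Z (I - A) l)) = card (Sigma (?Z I (k + l)) (\<lambda>E. ?Z E l))"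
    by (rule bij_betw_same_card)
  then show ?thesis
    using fin sub by (simp add: card_SigmaI)
qed

section \<open>Existence of a zero-sum subset of length \<open>q\<close>\<close>

lemma ex_zero_sum_subset_of_exponent_length:
  fixes p q k D c :: nat and s :: "'i \<Rightarrow> 'a"
  assumes p: "Factorial_Ring.prime p" "odd p" and q: "q = p ^ k"
    and D: "\<And>f. diff_vanish G p (carrier G) D f" "D + c = 2 * q" "c \<le> q"
    and I: "finite I" "s \<in> I \<rightarrow> carrier G" "card I + c + c div 2 + 2 = 4 * q"
  shows "zero_sum_subsets G s I q \<noteq> {}"
proof
  assume none: "zero_sum_subsets G s I q = {}"
  define N where "N J l = int (card (zero_sum_subsets G s J l))" for J l
  define h where "h = c div 2"
  \<comment> \<open>For \<open>r < q\<close>, \<open>v r\<close> selects the lengths congruent to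
    \<open>r\<close> modulo \<open>q\<close>. The weight \<open>u r\<close> also multiplies by the
    quotient: it gains \<open>v r\<close> in each period, so \<open>2 * q\<close> differences kill
    it.\<close>
  define v where "v r t = (of_bool (t mod q = r) :: int)" for r t
  define u where "u r t = v r t * int (t div q)" for r t
  define W where "W J w = (\<Sum>l<4 * q. (-1) ^ l * N J l * w l)" for J and w :: "nat \<Rightarrow> int"
  have q0: "0 < q" "odd q"
    using p by (auto simp: q prime_gt_0_nat)
  \<comment> \<open>\<open>2 * h < q\<close> is strict even for \<open>c = q\<close>, because
    \<open>q\<close> is odd.\<close>
  have h: "2 * h \<le> c" "c \<le> 2 * h + 1" "card I + c + h + 2 = 4 * q" "2 * h < q"
    using I(3) D(3) q0(2) by (auto simp: h_def) presburger
  have fin: "finite J" "s \<in> J \<rightarrow> carrier G" "card J \<le> card I" if "J \<subseteq> I" for J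
    using that I(1,2) finite_subset card_mono by (blast, blast, blast)
  have W_dvd: "int p dvd W J w"
    if "J \<subseteq> I" "D + b \<le> Suc (card J)" "\<And>t. int p dvd (fdiff ^^ b) w t" for J b w
    unfolding W_def N_def
    using that fin [OF that(1)] h(3) by (intro dvd_zero_sum_count [OF _ _ D(1), where b = b]) auto
  have W_v: "W J (v r) = (-1) ^ r * (N J r - N J (q + r) + N J (2 * q + r) - N J (3 * q + r))"
    if "r < q" for J r
    unfolding W_def using that q0
    by (subst sum_residue_class [of r q]) (auto simp: v_def power_add algebra_simps)
  have W_u: "W J (u r) = (-1) ^ r * (- N J (q + r) + 2 * N J (2 * q + r) - 3 * N J (3 * q + r))"
    if "r < q" for J r
    unfolding W_def using that q0
    by (subst sum_residue_class [of r q]) (auto simp: u_def v_def power_add algebra_simps)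
  have v_dvd: "int p dvd W J (v r)" if "J \<subseteq> I" "D + q \<le> Suc (card J)" for J r
  proof (rule W_dvd [OF that])
    show "int p dvd (fdiff ^^ q) (v r) t" for t
      unfolding q using p by (intro dvd_funpow_fdiff_periodic) (auto simp: v_def q)
  qed
  have N_q: "N J q = 0" if "J \<subseteq> I" for J
  proof -
    have "zero_sum_subsets G s J q \<subseteq> zero_sum_subsets G s I q"
      using that by (auto simp: zero_sum_subsets_def)
    then show ?thesis
      using none by (simp add: N_def)
  qed
  have N_0: "N J 0 = 1" if "J \<subseteq> I" for J
    using fin(1) [OF that] by (simp add: N_def zero_sum_subsets_0)
  have N_large: "N J l = 0" if "J \<subseteq> I" "card J < l" for J l
    using fin(1) [OF that(1)] that(2) by (simp add: N_def zero_sum_subsets_empty)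
  have N_2q': "int p dvd N J (2 * q) + 1"
    if "J \<subseteq> I" "D + q \<le> Suc (card J)" "N J (3 * q) = 0" for J
    using v_dvd [OF that(1,2), of 0] W_v [of 0 J] N_0 [OF that(1)] N_q [OF that(1)] that(3) q0
    by (simp add: add.commute)
  have not_dvd_1: "\<not> int p dvd 1"
    using prime_gt_1_nat [OF p(1)] by simp
  have N_3q: "N J (3 * q) = 0" if J: "J \<subseteq> I" for J
  proof (rule ccontr)
    assume "N J (3 * q) \<noteq> 0"
    then obtain E where E: "E \<subseteq> J" "card E = 3 * q" "finprod G s E = \<one>"
      by (auto simp: N_def zero_sum_subsets_def card_eq_0_iff)
    then have EI: "E \<subseteq> I"
      using J by auto
    \<comment> \<open>Dropping one index leaves no room for length \<open>3 * q\<close> but enough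
      for a zero-sum set of length \<open>2 * q\<close>, whose complement in \<open>E\<close> has
      the excluded length \<open>q\<close>.\<close>
    obtain E' where E': "E' \<subseteq> E" "card E' = 3 * q - 1"
      using E(2) obtain_subset_with_card_n [of "3 * q - 1" E] by auto
    then have E'I: "E' \<subseteq> I"
      using EI by auto
    have "N E' (3 * q) = 0"
      using N_large [OF E'I] E'(2) q0 by simp
    then have "int p dvd N E' (2 * q) + 1"
      using E'(2) D(2) q0 by (intro N_2q' [OF E'I]) auto
    then have "N E' (2 * q) \<noteq> 0"
      using not_dvd_1 by auto
    then have "zero_sum_subsets G s E' (2 * q) \<noteq> {}"
      by (auto simp: N_def)
    then obtain C where "C \<in> zero_sum_subsets G s E (2 * q)"
      using E'(1) by (auto simp: zero_sum_subsets_def)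
    then have "E - C \<in> zero_sum_subsets G s E q"
      using zero_sum_subsets_Diff [OF fin(1,2) [OF EI] E(3)] E(2) by fastforce
    then show False
      using N_q [OF EI] fin(1) [OF EI] by (auto simp: N_def finite_zero_sum_subsets)
  qed
  have N_2q: "int p dvd N J (2 * q) + 1" if "J \<subseteq> I" "D + q \<le> Suc (card J)" for J
    using N_2q' [OF that] N_3q [OF that(1)] by simp
  \<comment> \<open>Subtraction is truncated, so \<open>a = 0\<close> for \<open>c = q\<close>. The
    bound \<open>a + h \<le> q - 1 - h\<close> follows from \<open>2 * h < q\<close> in that case
    and from \<open>2 * h \<le> c\<close> otherwise.\<close>
  define a where "a = q - c - 1"
  have N_sym: "int p dvd N I r - N I (2 * q + r)" if r: "a \<le> r" "r \<le> a + h" for r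
  proof -
    let ?Z = "zero_sum_subsets G s"
    have "int p dvd (\<Sum>A\<in>?Z I r. N (I - A) (2 * q) + 1)"
    proof (rule dvd_sum)
      fix A assume "A \<in> ?Z I r"
      then have "A \<subseteq> I" "card A = r"
        by (auto simp: zero_sum_subsets_def)
      then have "card (I - A) = card I - r"
        using fin(1) by (simp add: card_Diff_subset)
      then show "int p dvd N (I - A) (2 * q) + 1"
        using r h D(2,3) by (intro N_2q) (auto simp: a_def)
    qed
    moreover have "int p dvd (\<Sum>E\<in>?Z I (r + 2 * q). N E (2 * q) + 1)"
    proof (rule dvd_sum)
      fix E assume "E \<in> ?Z I (r + 2 * q)"
      then show "int p dvd N E (2 * q) + 1"
        using r D(2) by (intro N_2q) (auto simp: zero_sum_subsets_def a_def)
    qed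
    moreover have "(\<Sum>A\<in>?Z I r. N (I - A) (2 * q)) = (\<Sum>E\<in>?Z I (r + 2 * q). N E (2 * q))"
      unfolding N_def of_nat_sum [symmetric] using card_zero_sum_pairs [OF I(1,2)] by simp
    ultimately have "int p dvd ((\<Sum>A\<in>?Z I r. N (I - A) (2 * q)) + N I r)
        - ((\<Sum>A\<in>?Z I r. N (I - A) (2 * q)) + N I (r + 2 * q))"
      by (intro dvd_diff) (simp_all add: sum.distrib N_def)
    then show ?thesis
      by (simp add: add.commute)
  qed
  have a: "a + h < q"
    using h q0 by (simp add: a_def)
  have "int p dvd W I ((fdiff ^^ 0) (u 0))"
  proof (rule differences_vanish [where A = "\<lambda>i r. W I ((fdiff ^^ i) (u r))" and h = h and a = a and q = q])
    fix i r assume r: "0 < r" "r < q"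
    \<comment> \<open>As \<open>0 < r < q\<close>, the shift lowers the residue without changing the
      quotient, so differences in \<open>t\<close> become differences in \<open>r\<close>.\<close>
    have "u r (Suc t) = u (r - 1) t" for t
      using r by (auto simp: u_def v_def mod_Suc div_Suc)
    then have "fdiff (u r) = (\<lambda>t. u r t - u (r - 1) t)"
      by (simp add: fdiff_def)
    then have "(fdiff ^^ Suc i) (u r) = (\<lambda>t. (fdiff ^^ i) (u r) t - (fdiff ^^ i) (u (r - 1)) t)"
      by (simp add: funpow_Suc_right funpow_fdiff_diff del: funpow.simps)
    then show "W I ((fdiff ^^ Suc i) (u r)) = W I ((fdiff ^^ i) (u r)) - W I ((fdiff ^^ i) (u (r - 1)))"
      by (simp add: W_def sum_subtractf right_diff_distrib del: funpow.simps)
  next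
    fix r
    show "int p dvd W I ((fdiff ^^ Suc h) (u r))"
    \<comment> \<open>Of the \<open>2 * q\<close> differences killing \<open>u r\<close>,
      \<open>h + 1\<close> are already applied; the others fit the size of \<open>I\<close>
      exactly.\<close>
    proof (rule W_dvd [where b = "2 * q - Suc h"])
      show "D + (2 * q - Suc h) \<le> Suc (card I)"
        using h D(2) by simp
      have "u r (t + q) = u r t + v r t" "v r (t + q) = v r t" for t
        using q0 by (auto simp: u_def v_def)
      then have "int p dvd (fdiff ^^ (2 * q)) (u r) t" for t
        using p unfolding q by (intro dvd_funpow_fdiff_quasiperiodic [where v = "v r"]) auto
      moreover have "2 * q = (2 * q - Suc h) + Suc h"
        using h by simp
      ultimately show "int p dvd (fdiff ^^ (2 * q - Suc h)) ((fdiff ^^ Suc h) (u r)) t" for t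
        by (metis comp_apply funpow_add)
    qed simp
  next
    fix r assume r: "a \<le> r" "r \<le> a + h"
    have rq: "r < q"
      using r a by simp
    \<comment> \<open>On the window these lengths exceed \<open>card I\<close>, so
      \<open>u r\<close> and \<open>v r\<close> differ only by the quantity controlled by
      \<open>N_sym\<close>.\<close>
    have "N I (3 * q + r) = 0"
      using r h D(3) by (intro N_large) (auto simp: a_def)
    then have "W I (u r) = W I (v r) - (-1) ^ r * (N I r - N I (2 * q + r))"
      using W_u [OF rq, of I] W_v [OF rq, of I] by (simp add: algebra_simps)
    moreover have "int p dvd W I (v r)"
      using h D(2) q0 by (intro v_dvd) auto
    ultimately show "int p dvd W I ((fdiff ^^ 0) (u r))"
      using N_sym [OF r] by simp
  qed (use a q0 in auto)
  then have "int p dvd 2 * N I (2 * q)"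
    using W_u [of 0 I] N_q N_3q q0 by simp
  moreover have "int p dvd 2 * (N I (2 * q) + 1)"
    using h D(2) q0 by (intro dvd_mult N_2q) auto
  ultimately have "int p dvd 2 * (N I (2 * q) + 1) - 2 * N I (2 * q)"
    by (rule dvd_diff [rotated])
  then have "int p dvd int 2"
    by (simp add: algebra_simps)
  then have "p dvd 2"
    by (simp only: int_dvd_int_iff)
  then have "p = 2"
    using p(1) primes_dvd_imp_eq two_is_prime_nat by blast
  then show False
    using p(2) by simp
qed

end

section \<open>From index sets to the bound on \<open>egz_constant\<close>\<close>

theorem theorem2p6:
  fixes G :: "('a, 'b) monoid_scheme" and p :: nat and c :: int
  assumes "Factorial_Ring.prime p" and "3 \<le> p"
    and "comm_group G" and "finite_p_group p G"
    and "int (davenport_constant G) = 2 * int (group_exponent G) - c"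
    and "1 \<le> c" and "c \<le> int (group_exponent G)"
  shows "real (egz_constant G)
           \<le> real (davenport_constant G) + 2 * real (group_exponent G)
             - (real_of_int c - 1) / 2 - 2"
proof -
  interpret comm_group G
    by (rule assms(3))
  let ?q = "group_exponent G"
  obtain n where fin: "finite (carrier G)" and n: "order G = p ^ n"
    using assms(4) unfolding finite_p_group_def by blast
  have odd: "odd p"
    using assms(1,2) prime_odd_nat [of p] by simp
  obtain k where k: "?q = p ^ k"
    using group_exponent_dvd_order [OF fin] n divides_primepow_nat [OF assms(1)] by auto
  define d where "d = nat c"
  have d: "c = int d" "davenport_constant G + d = 2 * ?q" "d \<le> ?q"
    using assms(5-7) by (auto simp: d_def)
  have q0: "0 < ?q" "odd ?q"
    using k odd by (auto intro: odd_pos)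
  have h: "2 * (d div 2) \<le> d" "d \<le> 2 * (d div 2) + 1"
    by simp_all
  define m where "m = 4 * ?q - 2 - d - d div 2"
  have m: "m + d + d div 2 + 2 = 4 * ?q"
    using d(3) q0 h(1) unfolding m_def by linarith
  have "egz_constant G \<le> m"
    unfolding egz_constant_def
  proof (rule Least_le, intro conjI allI impI; (elim conjE)?)
    show "0 < m"
      using m d(3) q0 h(1) by linarith
    fix S assume S: "sequence_over G S" "m \<le> size S"
    obtain xs where xs: "S = mset xs"
      by (metis ex_mset)
    let ?s = "(!) xs"
    have sub: "{..<m} \<subseteq> {..<length xs}"
      using S(2) xs by auto
    have s: "?s \<in> {..<m} \<rightarrow> carrier G"
      using S xs by (auto simp: sequence_over_def subset_iff)
    have "zero_sum_subsets G ?s {..<m} ?q \<noteq> {}"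
      using ex_zero_sum_subset_of_exponent_length [OF assms(1) odd k
          diff_vanish_davenport_constant [OF fin assms(1) odd n] d(2,3) _ s] m by simp
    then obtain U where U: "U \<subseteq> {..<m}" "card U = ?q" "finprod G ?s U = \<one>\<^bsub>G\<^esub>"
      by (auto simp: zero_sum_subsets_def)
    have "finite U" "?s \<in> U \<rightarrow> carrier G"
      using U(1) s finite_subset by auto
    then have "seq_sum G (image_mset ?s (mset_set U)) = \<one>\<^bsub>G\<^esub>"
      using U(3) by (simp add: seq_sum_image_mset)
    moreover have "image_mset ?s (mset_set U) \<subseteq># S"
      unfolding xs by (rule image_nth_subseteq_mset [OF subset_trans [OF U(1) sub]])
    ultimately show "\<exists>T. T \<subseteq># S \<and> seq_sum G T = \<one>\<^bsub>G\<^esub> \<and> size T = ?q"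
      using U(2) by (intro exI [of _ "image_mset ?s (mset_set U)"]) simp
  qed
  \<comment> \<open>Doubling clears the halves, and \<open>d \<le> 2 * (d div 2) + 1\<close>
    replaces \<open>d div 2\<close> by \<open>(d - 1) / 2\<close>.\<close>
  then have "2 * egz_constant G + 3 * d + 3 \<le> 8 * ?q"
    using m h(2) by linarith
  then have "2 * real (egz_constant G) + 3 * real d + 3 \<le> 8 * real ?q"
    using of_nat_mono [where 'a = real] by fastforce
  moreover have "real (davenport_constant G) + real d = 2 * real ?q"
    using d(2) by (metis of_nat_add of_nat_mult of_nat_numeral)
  ultimately show ?thesis
    using d(1) by (simp add: field_simps)
qed

end
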